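(* Let $\Omega=\{1,\dots,K\}$. For a generalized symmetric rank function $g:2^\Omega\to\mathbb{R}_+$, the Nash bargaining solution in $\mathcal{P}(g)=\{\mathbf{r}\in\mathbb{R}_+^K:\ \sum_{i\in S}r_i\le g(S)\ \ \forall S\subseteq\Omega\}$ with the canonical disagreement point can be computed in $O(K^2)$ time.
   Context: $\mathbb{R}_+$ denotes the nonnegative reals. A function $g:2^\Omega\to\mathbb{R}_+$ is a rank function if $g(\emptyset)=0$, $g(S)\le g(T)$ whenever $S\subseteq T$, and $g(S)+g(T)\ge g(S\cap T)+g(S\cup T)$ for all $S,T\subseteq\Omega$. A rank function $g$ is generalized symmetric if $g(S)=\phi\big(\sum_{i\in S}P_i\big)$ for all $S\subseteq\Omega$, where $\mathbf{P}=(P_1,\dots,P_K)\in\mathbb{R}_+^K$ and $\phi$ is a monotonically increasing and concave function with $\phi(0)=0$. The canonical disagreement point is $\mathbf{d}^*=(d_1^*,\dots,d_K^* )$ with $d_i^*=g(\Omega)-g(\Omega\setminus\{i\})$. Given a region $\mathcal{R}\subseteq\mathbb{R}_+^K$ and a disagreement point $\mathbf{d}\in\mathcal{R}$, the Nash bargaining solution is the point maximizing $\sum_{i=1}^K\log(r_i-d_i)$ over $\{\mathbf{r}\in\mathcal{R}:\ r_i\ge d_i\ \forall i\}$. *)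

theory Defs
  imports "HOL-Analysis.Analysis" "HOL-Library.Landau_Symbols"
begin

section \<open>Rank functions and the Nash bargaining solution\<close>

text \<open>
  The coordinates are indexed by a finite set \<open>\<Omega>\<close>, later \<open>{1..K}\<close> with \<open>K\<close> a bound variable.
  Points of the nonnegative orthant are the functions in \<open>\<Omega> \<rightarrow>\<^sub>E {0..}\<close>, so that two points are
  equal iff they agree on \<open>\<Omega>\<close>.
\<close>

definition rank_function :: "'a set \<Rightarrow> ('a set \<Rightarrow> real) \<Rightarrow> bool" where
  "rank_function \<Omega> g \<longleftrightarrow>
     (\<forall>S. S \<subseteq> \<Omega> \<longrightarrow> g S \<ge> 0) \<and>
     g {} = 0 \<and>
     (\<forall>S T. S \<subseteq> T \<and> T \<subseteq> \<Omega> \<longrightarrow> g S \<le> g T) \<and>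
     (\<forall>S T. S \<subseteq> \<Omega> \<and> T \<subseteq> \<Omega> \<longrightarrow> g S + g T \<ge> g (S \<inter> T) + g (S \<union> T))"

definition generalized_symmetric ::
    "'a set \<Rightarrow> ('a \<Rightarrow> real) \<Rightarrow> (real \<Rightarrow> real) \<Rightarrow> ('a set \<Rightarrow> real) \<Rightarrow> bool" where
  "generalized_symmetric \<Omega> P \<phi> g \<longleftrightarrow>
     (\<forall>i\<in>\<Omega>. P i \<ge> 0) \<and>
     mono_on {0..} \<phi> \<and> concave_on {0..} \<phi> \<and> \<phi> 0 = 0 \<and>
     (\<forall>S. S \<subseteq> \<Omega> \<longrightarrow> g S = \<phi> (\<Sum>i\<in>S. P i))"

definition polymatroid :: "'a set \<Rightarrow> ('a set \<Rightarrow> real) \<Rightarrow> ('a \<Rightarrow> real) set" where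
  "polymatroid \<Omega> g = {r \<in> \<Omega> \<rightarrow>\<^sub>E {0..}. \<forall>S. S \<subseteq> \<Omega> \<longrightarrow> (\<Sum>i\<in>S. r i) \<le> g S}"

definition canonical_disagreement :: "'a set \<Rightarrow> ('a set \<Rightarrow> real) \<Rightarrow> 'a \<Rightarrow> real" where
  "canonical_disagreement \<Omega> g = (\<lambda>i\<in>\<Omega>. g \<Omega> - g (\<Omega> - {i}))"

text \<open>
  The library has \<open>ln 0 = 0\<close> on the reals. On the boundary \<open>r i = d i\<close> the Nash objective has to
  be \<open>-\<infinity>\<close>, hence the extended logarithm.
\<close>

definition elog :: "real \<Rightarrow> ereal" where
  "elog x = (if x > 0 then ereal (ln x) else - \<infinity>)"

text \<open>
  If some point of the region strictly dominates \<open>d\<close>, the objective is strictly concave where it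
  is finite, so in a convex region there is at most one solution. If there is no such point, the
  objective is constantly \<open>-\<infinity>\<close> and every feasible point counts as a solution.
\<close>

definition nash_bargaining_solution ::
    "'a set \<Rightarrow> ('a \<Rightarrow> real) set \<Rightarrow> ('a \<Rightarrow> real) \<Rightarrow> ('a \<Rightarrow> real) \<Rightarrow> bool" where
  "nash_bargaining_solution \<Omega> R d r \<longleftrightarrow>
     is_arg_max (\<lambda>r. \<Sum>i\<in>\<Omega>. elog (r i - d i)) (\<lambda>r. r \<in> R \<and> (\<forall>i\<in>\<Omega>. r i \<ge> d i)) r"


section \<open>A real random access machine with an oracle\<close>

text \<open>
  Running time is measured on a real RAM programmed in a while language. The memory consists of
  arrays of natural numbers and arrays of reals; array names are constants of the program text,
  indices are computed. Naturals (indices and counters) support constants, addition, truncated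
  subtraction and comparison; reals support integer constants, the field operations (with
  \<open>x / 0 = 0\<close>), comparison, and evaluation of the oracle \<open>\<phi>\<close>. There is no rounding from reals to
  naturals and no multiplication of naturals, which would make unit-cost accounting unrealistic.
\<close>

datatype nexp =
    NConst nat
  | NGet nat nexp
  | NPlus nexp nexp
  | NMinus nexp nexp

datatype rexp =
    RConst int
  | RGet nat nexp
  | RPlus rexp rexp
  | RMinus rexp rexp
  | RTimes rexp rexp
  | RDivide rexp rexp
  | Oracle rexp

datatype bexp =
    NLess nexp nexp
  | RLess rexp rexp
  | BNot bexp
  | BAnd bexp bexp

datatype com =
    Skip
  | NAssign nat nexp nexp
  | RAssign nat nexp rexp
  | Seq com com
  | Cond bexp com com
  | Loop bexp com

record store =
  nats :: "nat \<Rightarrow> nat \<Rightarrow> nat"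
  reals :: "nat \<Rightarrow> nat \<Rightarrow> real"

fun nval :: "store \<Rightarrow> nexp \<Rightarrow> nat" where
  "nval s (NConst n) = n"
| "nval s (NGet a i) = nats s a (nval s i)"
| "nval s (NPlus x y) = nval s x + nval s y"
| "nval s (NMinus x y) = nval s x - nval s y"

fun rval :: "(real \<Rightarrow> real) \<Rightarrow> store \<Rightarrow> rexp \<Rightarrow> real" where
  "rval \<phi> s (RConst c) = of_int c"
| "rval \<phi> s (RGet a i) = reals s a (nval s i)"
| "rval \<phi> s (RPlus x y) = rval \<phi> s x + rval \<phi> s y"
| "rval \<phi> s (RMinus x y) = rval \<phi> s x - rval \<phi> s y"
| "rval \<phi> s (RTimes x y) = rval \<phi> s x * rval \<phi> s y"
| "rval \<phi> s (RDivide x y) = rval \<phi> s x / rval \<phi> s y"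
| "rval \<phi> s (Oracle x) = \<phi> (rval \<phi> s x)"

fun bval :: "(real \<Rightarrow> real) \<Rightarrow> store \<Rightarrow> bexp \<Rightarrow> bool" where
  "bval \<phi> s (NLess x y) \<longleftrightarrow> nval s x < nval s y"
| "bval \<phi> s (RLess x y) \<longleftrightarrow> rval \<phi> s x < rval \<phi> s y"
| "bval \<phi> s (BNot b) \<longleftrightarrow> \<not> bval \<phi> s b"
| "bval \<phi> s (BAnd b c) \<longleftrightarrow> bval \<phi> s b \<and> bval \<phi> s c"

text \<open>
  Every constant, memory access, arithmetic or logical operation, comparison and oracle call costs
  one unit of time, and so does every executed command in addition to its expressions.
\<close>

fun ncost :: "nexp \<Rightarrow> nat" where
  "ncost (NConst n) = 1"
| "ncost (NGet a i) = ncost i + 1"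
| "ncost (NPlus x y) = ncost x + ncost y + 1"
| "ncost (NMinus x y) = ncost x + ncost y + 1"

fun rcost :: "rexp \<Rightarrow> nat" where
  "rcost (RConst c) = 1"
| "rcost (RGet a i) = ncost i + 1"
| "rcost (RPlus x y) = rcost x + rcost y + 1"
| "rcost (RMinus x y) = rcost x + rcost y + 1"
| "rcost (RTimes x y) = rcost x + rcost y + 1"
| "rcost (RDivide x y) = rcost x + rcost y + 1"
| "rcost (Oracle x) = rcost x + 1"

fun bcost :: "bexp \<Rightarrow> nat" where
  "bcost (NLess x y) = ncost x + ncost y + 1"
| "bcost (RLess x y) = rcost x + rcost y + 1"
| "bcost (BNot b) = bcost b + 1"
| "bcost (BAnd b c) = bcost b + bcost c + 1"

definition nats_put :: "nat \<Rightarrow> nat \<Rightarrow> nat \<Rightarrow> store \<Rightarrow> store" where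
  "nats_put a i v s = s\<lparr>nats := (nats s)(a := (nats s a)(i := v))\<rparr>"

definition reals_put :: "nat \<Rightarrow> nat \<Rightarrow> real \<Rightarrow> store \<Rightarrow> store" where
  "reals_put a i v s = s\<lparr>reals := (reals s)(a := (reals s a)(i := v))\<rparr>"

text \<open>\<open>exec \<phi> c s t s'\<close>: started in \<open>s\<close>, the command \<open>c\<close> halts in \<open>s'\<close> after exactly \<open>t\<close> units of time.\<close>

inductive exec :: "(real \<Rightarrow> real) \<Rightarrow> com \<Rightarrow> store \<Rightarrow> nat \<Rightarrow> store \<Rightarrow> bool" for \<phi> where
  Skip: "exec \<phi> Skip s 1 s"
| NAssign: "exec \<phi> (NAssign a i x) s (ncost i + ncost x + 1) (nats_put a (nval s i) (nval s x) s)"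
| RAssign: "exec \<phi> (RAssign a i x) s (ncost i + rcost x + 1) (reals_put a (nval s i) (rval \<phi> s x) s)"
| Seq: "exec \<phi> c s t s' \<Longrightarrow> exec \<phi> d s' u s'' \<Longrightarrow> exec \<phi> (Seq c d) s (t + u + 1) s''"
| CondTrue: "bval \<phi> s b \<Longrightarrow> exec \<phi> c s t s' \<Longrightarrow> exec \<phi> (Cond b c d) s (bcost b + t + 1) s'"
| CondFalse: "\<not> bval \<phi> s b \<Longrightarrow> exec \<phi> d s t s' \<Longrightarrow> exec \<phi> (Cond b c d) s (bcost b + t + 1) s'"
| LoopFalse: "\<not> bval \<phi> s b \<Longrightarrow> exec \<phi> (Loop b c) s (bcost b + 1) s"
| LoopTrue: "bval \<phi> s b \<Longrightarrow> exec \<phi> c s t s' \<Longrightarrow> exec \<phi> (Loop b c) s' u s'' \<Longrightarrow>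
    exec \<phi> (Loop b c) s (bcost b + t + u + 1) s''"

inductive_cases exec_SkipE: "exec \<phi> Skip s t s'"
inductive_cases exec_NAssignE: "exec \<phi> (NAssign a i x) s t s'"
inductive_cases exec_RAssignE: "exec \<phi> (RAssign a i x) s t s'"
inductive_cases exec_SeqE: "exec \<phi> (Seq c d) s t s'"
inductive_cases exec_CondE: "exec \<phi> (Cond b c d) s t s'"
inductive_cases exec_LoopE: "exec \<phi> (Loop b c) s t s'"

lemma exec_deterministic:
  "exec \<phi> c s t s' \<Longrightarrow> exec \<phi> c s u s'' \<Longrightarrow> t = u \<and> s' = s''"
proof (induction arbitrary: u s'' rule: exec.induct)
  case (Skip s)
  then show ?case by (rule exec_SkipE) simp
next
  case (NAssign a i x s)
  then show ?case by (rule exec_NAssignE) simp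
next
  case (RAssign a i x s)
  then show ?case by (rule exec_RAssignE) simp
next
  case (Seq c s t s' d v s3)
  from Seq.prems obtain t1 s1 t2 where 1: "exec \<phi> c s t1 s1" "exec \<phi> d s1 t2 s''" "u = t1 + t2 + 1"
    by (rule exec_SeqE) simp
  from Seq.IH(1)[OF 1(1)] have 2: "t = t1" "s1 = s'" by simp_all
  have "v = t2 \<and> s3 = s''" by (rule Seq.IH(2)) (rule 1(2)[unfolded 2(2)])
  then show ?case using 1(3) 2(1) by simp
next
  case (CondTrue s b c t s' d)
  from CondTrue.prems CondTrue.hyps(1) obtain t1 where 1: "exec \<phi> c s t1 s''" "u = bcost b + t1 + 1"
    by (elim exec_CondE) simp_all
  then show ?case using CondTrue.IH[OF 1(1)] by simp
next
  case (CondFalse s b d t s' c)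
  from CondFalse.prems CondFalse.hyps(1) obtain t1 where 1: "exec \<phi> d s t1 s''" "u = bcost b + t1 + 1"
    by (elim exec_CondE) simp_all
  then show ?case using CondFalse.IH[OF 1(1)] by simp
next
  case (LoopFalse s b c)
  from LoopFalse.prems LoopFalse.hyps show ?case by - (erule exec_LoopE; simp)
next
  case (LoopTrue s b c t s' v s3)
  from LoopTrue.prems LoopTrue.hyps(1)
  obtain t1 s1 t2 where 1: "exec \<phi> c s t1 s1" "exec \<phi> (Loop b c) s1 t2 s''" "u = bcost b + t1 + t2 + 1"
    by - (erule exec_LoopE; simp)
  from LoopTrue.IH(1)[OF 1(1)] have 2: "t = t1" "s1 = s'" by simp_all
  have "v = t2 \<and> s3 = s''" by (rule LoopTrue.IH(2)) (rule 1(2)[unfolded 2(2)])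
  then show ?case using 1(3) 2(1) by simp
qed

text \<open>
  Input convention: \<open>K\<close> is cell 0 of the array 0 of naturals, \<open>P 1, \<dots>, P K\<close> are the cells
  \<open>1, \<dots>, K\<close> of the array 0 of reals, and all other cells are 0. Output convention: the result is
  left in the cells \<open>1, \<dots>, K\<close> of the array 1 of reals.
\<close>

definition input_store :: "nat \<Rightarrow> (nat \<Rightarrow> real) \<Rightarrow> store" where
  "input_store K P =
     \<lparr>nats = (\<lambda>a i. if a = 0 \<and> i = 0 then K else 0),
      reals = (\<lambda>a i. if a = 0 \<and> i \<in> {1..K} then P i else 0)\<rparr>"

definition output_vector :: "nat \<Rightarrow> store \<Rightarrow> nat \<Rightarrow> real" where
  "output_vector K s = (\<lambda>i\<in>{1..K}. reals s 1 i)"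

end

theory Submission
  imports Defs
begin

text \<open>
  Substituting \<open>x = r - d\<close> turns the region into the polymatroid of the surplus
  \<open>f S = g S - (\<Sum>i\<in>S. d i)\<close>, a nonnegative submodular function. By concavity of \<open>\<phi>\<close>, replacing an
  element of \<open>S\<close> by one outside \<open>S\<close> with smaller \<open>P\<close> does not increase \<open>f\<close>, because
  \<open>\<phi> (A + p) + \<phi> (W - p)\<close>, with \<open>W\<close> the sum of all \<open>P i\<close>, grows when the two arguments move
  towards each other. Hence the \<open>k\<close> elements of smallest \<open>P\<close> minimize \<open>f\<close> among all sets of size
  \<open>k\<close>; call the minimum \<open>F k\<close>. The solution assigns to the element in position \<open>i\<close> the slope at \<open>i\<close>
  of the greatest convex minorant of \<open>F\<close>. It is feasible because, between two points where the
  minorant touches \<open>F\<close>, the slope is constant, and it is optimal by \<open>ln u \<le> u - 1\<close> and Abel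
  summation. From a point \<open>(i, X)\<close> of the minorant the next slope is the minimum of
  \<open>(F k - X) / (k - i)\<close> over \<open>k > i\<close>, so all slopes cost quadratic time; positions are found by
  counting predecessors.
\<close>

section \<open>Slopes of the convex minorant\<close>

text \<open>The starting value 0 stands for \<open>F 0\<close>. Beyond index \<open>n\<close> the
  minimum ranges over an empty set, so only the indices up to \<open>n\<close> carry
  meaning.\<close>

fun lower_hull :: "(nat \<Rightarrow> real) \<Rightarrow> nat \<Rightarrow> nat \<Rightarrow> real" where
  "lower_hull F n 0 = 0"
| "lower_hull F n (Suc i) =
     lower_hull F n i + Min ((\<lambda>k. (F k - lower_hull F n i) / real (k - i)) ` {Suc i..n})"

declare lower_hull.simps(2) [simp del]

definition hull_slope :: "(nat \<Rightarrow> real) \<Rightarrow> nat \<Rightarrow> nat \<Rightarrow> real" where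
  "hull_slope F n i = Min ((\<lambda>k. (F k - lower_hull F n i) / real (k - i)) ` {Suc i..n})"

lemma hull_Suc: "lower_hull F n (Suc i) = lower_hull F n i + hull_slope F n i"
  by (simp add: hull_slope_def lower_hull.simps(2))

lemma hull_eq_sum: "lower_hull F n k = (\<Sum>i<k. hull_slope F n i)"
  by (induction k) (simp_all only: lower_hull.simps(1) hull_Suc, simp_all)

lemma hull_line_below:
  assumes "i < k" "k \<le> n"
  shows "lower_hull F n i + hull_slope F n i * real (k - i) \<le> F k"
proof -
  have "hull_slope F n i \<le> (F k - lower_hull F n i) / real (k - i)"
    unfolding hull_slope_def using assms by (intro Min_le) auto
  moreover have "real (k - i) > 0" using assms by simp
  ultimately show ?thesis by (simp add: pos_le_divide_eq)
qed

lemma hull_slope_attained: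
  assumes "i < n"
  obtains k where "i < k" "k \<le> n" "F k = lower_hull F n i + hull_slope F n i * real (k - i)"
proof -
  have "hull_slope F n i \<in> (\<lambda>k. (F k - lower_hull F n i) / real (k - i)) ` {Suc i..n}"
    unfolding hull_slope_def using assms by (intro Min_in) auto
  then obtain k where k: "k \<in> {Suc i..n}" "hull_slope F n i = (F k - lower_hull F n i) / real (k - i)"
    by auto
  then have "F k = lower_hull F n i + hull_slope F n i * real (k - i)" by simp
  from that[OF _ _ this] k(1) show ?thesis by auto
qed

text \<open>From index \<open>n - 1\<close> the only candidate left is \<open>k = n\<close>, so the
  last step lands on \<open>F n\<close>. The assumption settles \<open>n = 0\<close>.\<close>

lemma hull_end:
  assumes "F 0 = 0"
  shows "lower_hull F n n = F n"
proof (cases n)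
  case (Suc i)
  then obtain k where "i < k" "k \<le> n" "F k = lower_hull F n i + hull_slope F n i * real (k - i)"
    using hull_slope_attained[of i n F] by auto
  moreover from this have "k = Suc i" using Suc by simp
  ultimately show ?thesis using Suc by (simp add: hull_Suc)
qed (use assms in simp)

text \<open>The line leaving index \<open>i\<close> passes through the minorant at
  \<open>Suc i\<close> and stays below every later \<open>F k\<close>, in particular below the one
  that determines the next slope. This is convexity.\<close>

lemma hull_slope_Suc_ge:
  assumes "Suc i < n"
  shows "hull_slope F n i \<le> hull_slope F n (Suc i)"
proof -
  obtain k where k: "Suc i < k" "k \<le> n"
    "F k = lower_hull F n (Suc i) + hull_slope F n (Suc i) * real (k - Suc i)"
    using hull_slope_attained assms by blast
  have "lower_hull F n i + hull_slope F n i * real (k - i) \<le> F k"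
    using hull_line_below[of i k n F] k by simp
  then have "hull_slope F n i * real (k - i) \<le>
      hull_slope F n i + hull_slope F n (Suc i) * real (k - Suc i)"
    using k(3) by (simp add: hull_Suc)
  moreover have "real (k - i) = real (k - Suc i) + 1" using k by simp
  ultimately have "hull_slope F n i * real (k - Suc i) \<le> hull_slope F n (Suc i) * real (k - Suc i)"
    by (simp add: algebra_simps)
  then show ?thesis using k by simp
qed

text \<open>Without contact at \<open>Suc i\<close>, the point \<open>k\<close> that determines the
  slope at \<open>i\<close> lies beyond \<open>Suc i\<close>. It is then still a candidate there, so
  the next slope cannot be larger.\<close>

lemma hull_slope_Suc_eq:
  assumes "F 0 = 0" "Suc i < n" "lower_hull F n (Suc i) \<noteq> F (Suc i)"
  shows "hull_slope F n (Suc i) = hull_slope F n i"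
proof -
  obtain k where k: "i < k" "k \<le> n" "F k = lower_hull F n i + hull_slope F n i * real (k - i)"
    using hull_slope_attained assms(2) by (metis Suc_lessD)
  have ne: "k \<noteq> Suc i" using k assms(3) by (auto simp: hull_Suc)
  then have "lower_hull F n (Suc i) + hull_slope F n (Suc i) * real (k - Suc i) \<le> F k"
    using k by (intro hull_line_below) auto
  then have "hull_slope F n i + hull_slope F n (Suc i) * real (k - Suc i) \<le>
      hull_slope F n i * real (k - i)"
    using k(3) by (simp add: hull_Suc)
  moreover have "real (k - i) = real (k - Suc i) + 1" using k by simp
  ultimately have "hull_slope F n (Suc i) * real (k - Suc i) \<le> hull_slope F n i * real (k - Suc i)"
    by (simp add: algebra_simps)
  then have "hull_slope F n (Suc i) \<le> hull_slope F n i" using k ne by simp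
  with hull_slope_Suc_ge[OF assms(2)] show ?thesis by (simp add: antisym)
qed

lemma hull_slope_mono:
  assumes "i \<le> k" "k < n"
  shows "hull_slope F n i \<le> hull_slope F n k"
  using assms
proof (induction k rule: dec_induct)
  case (step k)
  then show ?case using hull_slope_Suc_ge[of k n F] by simp
qed simp

lemma hull_slope_const:
  assumes "F 0 = 0" "i \<le> k" "k < n" "\<And>m. i < m \<Longrightarrow> m \<le> k \<Longrightarrow> lower_hull F n m \<noteq> F m"
  shows "hull_slope F n k = hull_slope F n i"
  using assms(2-4)
proof (induction k rule: dec_induct)
  case (step k)
  moreover have "lower_hull F n (Suc k) \<noteq> F (Suc k)" using step by simp
  ultimately show ?case using hull_slope_Suc_eq[of F k n] assms(1) by simp
qed simp

section \<open>Optimality of the slopes for sums of logarithms\<close>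

lemma abel_weighted_sum_le:
  fixes u w :: "nat \<Rightarrow> real"
  assumes "\<And>k. Suc k < n \<Longrightarrow> w (Suc k) \<le> w k"
    and "\<And>k. Suc k < n \<Longrightarrow> w (Suc k) = w k \<or> (\<Sum>i<Suc k. u i) \<le> 0"
  shows "k < n \<Longrightarrow> (\<Sum>i<Suc k. u i * w i) \<le> w k * (\<Sum>i<Suc k. u i)"
proof (induction k)
  case (Suc k)
  \<comment> \<open>Replacing \<open>w k\<close> by \<open>w (Suc k)\<close> in front of the partial
    sum does not decrease the product: either the weights agree or the partial sum is not
    positive.\<close>
  have "(w k - w (Suc k)) * (\<Sum>i<Suc k. u i) \<le> 0"
    using assms(1,2)[of k] Suc.prems by (auto intro: mult_nonneg_nonpos)
  with Suc show ?case by (simp add: algebra_simps)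
qed (simp add: mult.commute)

text \<open>By \<open>ln u \<le> u - 1\<close> at \<open>u = z i / x i\<close>, it suffices that the
  sum of \<open>(z i - x i) / x i\<close> is at most 0. The weights \<open>1 / x i\<close> never
  increase and change only where the minorant touches \<open>F\<close>; there the partial sums of
  \<open>z\<close> cannot exceed those of \<open>x\<close>.\<close>

lemma hull_slope_maximizes_ln:
  fixes z :: "nat \<Rightarrow> real"
  assumes F0: "F 0 = 0" and pos: "\<And>i. i < n \<Longrightarrow> hull_slope F n i > 0"
    and z: "\<And>i. i < n \<Longrightarrow> z i > 0" and le: "\<And>k. k \<le> n \<Longrightarrow> (\<Sum>i<k. z i) \<le> F k"
  shows "(\<Sum>i<n. ln (z i)) \<le> (\<Sum>i<n. ln (hull_slope F n i))"
proof (cases n)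
  case (Suc m)
  define x where "x = hull_slope F n"
  define w where "w i = 1 / x i" for i
  have xpos: "x i > 0" if "i < n" for i using pos[OF that] by (simp add: x_def)
  have sums: "(\<Sum>i<k. z i - x i) = (\<Sum>i<k. z i) - lower_hull F n k" for k
    by (simp add: sum_subtractf hull_eq_sum x_def)
  have "(\<Sum>i<Suc m. (z i - x i) * w i) \<le> w m * (\<Sum>i<Suc m. z i - x i)"
  proof (rule abel_weighted_sum_le)
    show "w (Suc k) \<le> w k" if "Suc k < n" for k
      unfolding w_def using hull_slope_Suc_ge[OF that, of F] xpos[of k] that
      by (intro divide_left_mono mult_pos_pos xpos) (auto simp: x_def)
    show "w (Suc k) = w k \<or> (\<Sum>i<Suc k. z i - x i) \<le> 0" if "Suc k < n" for k
    proof (cases "lower_hull F n (Suc k) = F (Suc k)")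
      case True
      then show ?thesis unfolding sums using le[of "Suc k"] that by simp
    next
      case False
      then show ?thesis using hull_slope_Suc_eq[where F=F, OF F0 that] by (simp add: w_def x_def)
    qed
  qed (use Suc in simp)
  also have "\<dots> \<le> 0"
    unfolding sums using le[of n] hull_end[of F n, OF F0] xpos[of m] Suc
    by (intro mult_nonneg_nonpos) (auto simp: w_def)
  finally have *: "(\<Sum>i<n. (z i - x i) * w i) \<le> 0" using Suc by simp
  have "(\<Sum>i<n. ln (z i)) - (\<Sum>i<n. ln (x i)) = (\<Sum>i<n. ln (z i / x i))"
    unfolding sum_subtractf[symmetric]
  proof (intro sum.cong refl)
    fix i assume "i \<in> {..<n}"
    then have "x i > 0" "z i > 0" by (simp_all add: xpos z)
    then show "ln (z i) - ln (x i) = ln (z i / x i)" by (simp add: ln_div)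
  qed
  also have "\<dots> \<le> (\<Sum>i<n. z i / x i - 1)"
    using z xpos by (intro sum_mono ln_le_minus_one) simp
  also have "\<dots> = (\<Sum>i<n. (z i - x i) * w i)"
  proof (intro sum.cong refl)
    fix i assume "i \<in> {..<n}"
    then have "x i > 0" by (simp add: xpos)
    then show "z i / x i - 1 = (z i - x i) * w i" by (simp add: w_def diff_divide_distrib)
  qed
  finally show ?thesis using * by (simp add: x_def)
qed simp

section \<open>Initial sets of an order and feasibility of the slopes\<close>

definition initial_set :: "'a set \<Rightarrow> ('a \<Rightarrow> nat) \<Rightarrow> nat \<Rightarrow> 'a set" where
  "initial_set \<Omega> \<rho> k = {i \<in> \<Omega>. \<rho> i < k}"

lemma bij_betw_initial_set:
  assumes "bij_betw \<rho> \<Omega> {..<n}" "k \<le> n"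
  shows "bij_betw \<rho> (initial_set \<Omega> \<rho> k) {..<k}"
proof -
  have "\<rho> ` initial_set \<Omega> \<rho> k = {..<k}"
  proof
    show "{..<k} \<subseteq> \<rho> ` initial_set \<Omega> \<rho> k"
    proof
      fix m assume "m \<in> {..<k}"
      then have "m \<in> \<rho> ` \<Omega>" using assms by (auto simp: bij_betw_def)
      then show "m \<in> \<rho> ` initial_set \<Omega> \<rho> k"
        using \<open>m \<in> {..<k}\<close> by (auto simp: initial_set_def)
    qed
  qed (auto simp: initial_set_def)
  moreover have "inj_on \<rho> (initial_set \<Omega> \<rho> k)"
    using assms(1) by (auto simp: bij_betw_def initial_set_def inj_on_def)
  ultimately show ?thesis by (simp add: bij_betw_def)
qed

lemma card_initial_set:
  assumes "bij_betw \<rho> \<Omega> {..<n}" "k \<le> n"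
  shows "card (initial_set \<Omega> \<rho> k) = k"
  using bij_betw_same_card[OF bij_betw_initial_set[OF assms]] by simp

text \<open>Strong induction on \<open>k\<close> for the part of \<open>S\<close> in the first
  \<open>k\<close> positions, cut at the last index \<open>j < k\<close> where the minorant touches
  \<open>F\<close>. The elements of \<open>S\<close> between \<open>j\<close> and \<open>k\<close>
  all receive the slope at \<open>j\<close>, and submodularity pays for them on top of the induction
  hypothesis for \<open>j\<close>.\<close>

lemma hull_slope_feasible:
  fixes f :: "'a set \<Rightarrow> real"
  assumes bij: "bij_betw \<rho> \<Omega> {..<n}"
    and sub: "\<And>S T. S \<subseteq> \<Omega> \<Longrightarrow> T \<subseteq> \<Omega> \<Longrightarrow> f (S \<inter> T) + f (S \<union> T) \<le> f S + f T"
    and f0: "f {} = 0"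
    and least: "\<And>S. S \<subseteq> \<Omega> \<Longrightarrow> F (card S) \<le> f S"
    and F: "\<And>k. k \<le> n \<Longrightarrow> F k = f (initial_set \<Omega> \<rho> k)"
    and S: "S \<subseteq> \<Omega>"
  shows "(\<Sum>i\<in>S. hull_slope F n (\<rho> i)) \<le> f S"
proof -
  let ?I = "initial_set \<Omega> \<rho>"
  have fin: "finite \<Omega>" using bij bij_betw_finite by blast
  have I: "?I k \<subseteq> \<Omega>" "finite (?I k)" for k using fin by (auto simp: initial_set_def)
  have F0: "F 0 = 0" using F[of 0] f0 by (simp add: initial_set_def)
  have "(\<Sum>i\<in>S \<inter> ?I k. hull_slope F n (\<rho> i)) \<le> f (S \<inter> ?I k)" if "k \<le> n" for k
    using that
  proof (induction k rule: less_induct)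
    case (less k)
    show ?case
    proof (cases "k = 0")
      case True
      then show ?thesis by (simp add: f0 initial_set_def)
    next
      case False
      define j where "j = Max {m. m < k \<and> lower_hull F n m = F m}"
      have "j \<in> {m. m < k \<and> lower_hull F n m = F m}"
        unfolding j_def using False F0 by (intro Max_in) (auto intro!: exI[of _ 0])
      then have j: "j < k" "lower_hull F n j = F j" by auto
      have last: "lower_hull F n m \<noteq> F m" if "j < m" "m < k" for m
        using that Max_ge[of "{m. m < k \<and> lower_hull F n m = F m}" m]
        by (force simp: j_def[symmetric])
      define B where "B = S \<inter> ?I k - ?I j"
      have const: "hull_slope F n (\<rho> i) = hull_slope F n j" if "i \<in> B" for i
        using that j less.prems
        by (intro hull_slope_const F0 last) (auto simp: B_def initial_set_def)
      have Iss: "?I j \<subseteq> ?I k" using j by (auto simp: initial_set_def)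
      have split: "S \<inter> ?I k = (S \<inter> ?I j) \<union> B" "(S \<inter> ?I j) \<inter> B = {}" "finite B"
        using Iss I by (auto simp: B_def)
      have "card (?I j \<union> (S \<inter> ?I k)) = card (?I j \<union> B)"
        by (rule arg_cong[of _ _ card]) (auto simp: B_def)
      also have "\<dots> = j + card B"
        using card_initial_set[OF bij, of j] j less.prems split I
        by (subst card_Un_disjoint) (auto simp: B_def)
      finally have card: "card (?I j \<union> (S \<inter> ?I k)) = j + card B" .
      have "j + card B \<le> n"
        unfolding card[symmetric]
        using card_mono[of \<Omega> "?I j \<union> (S \<inter> ?I k)"] I fin bij_betw_same_card[OF bij] by auto
      \<comment> \<open>The line leaving \<open>(j, F j)\<close> stays below \<open>F\<close> at
        \<open>j + card B\<close>; for empty \<open>B\<close> both sides are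
        \<open>F j\<close>.\<close>
      then have "F j + hull_slope F n j * card B \<le> F (j + card B)"
        using hull_line_below[of j "j + card B" n F] j by (cases "card B = 0") auto
      also have "\<dots> \<le> f (?I j \<union> (S \<inter> ?I k))"
        using least[of "?I j \<union> (S \<inter> ?I k)"] I card by auto
      also have "\<dots> \<le> f (?I j) + f (S \<inter> ?I k) - f (S \<inter> ?I j)"
      proof -
        have "?I j \<inter> (S \<inter> ?I k) = S \<inter> ?I j" using Iss by auto
        moreover have "S \<inter> ?I k \<subseteq> \<Omega>" using I by blast
        ultimately show ?thesis using sub[of "?I j" "S \<inter> ?I k"] I by simp
      qed
      finally have "hull_slope F n j * card B \<le> f (S \<inter> ?I k) - f (S \<inter> ?I j)"
        using F[of j] j less.prems by simp
      moreover have "(\<Sum>i\<in>S \<inter> ?I k. hull_slope F n (\<rho> i)) =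
          (\<Sum>i\<in>S \<inter> ?I j. hull_slope F n (\<rho> i)) + hull_slope F n j * card B"
        unfolding split(1) using split I by (subst sum.union_disjoint) (simp_all add: const)
      ultimately show ?thesis using less.IH[of j] j less.prems by simp
    qed
  qed
  moreover have "S \<inter> ?I n = S" using S bij by (auto simp: initial_set_def bij_betw_def)
  ultimately show ?thesis by (metis order_refl)
qed

section \<open>The Nash objective and its boundary values\<close>

lemma sum_elog_finite:
  assumes "finite A" "\<And>i. i \<in> A \<Longrightarrow> h i > 0"
  shows "(\<Sum>i\<in>A. elog (h i)) = ereal (\<Sum>i\<in>A. ln (h i))"
  using assms by (simp add: elog_def)

text \<open>In \<open>ereal\<close> the sum of \<open>\<infinity>\<close> and
  \<open>- \<infinity>\<close> is \<open>\<infinity>\<close>, so the remaining summands must first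
  be shown not to reach \<open>\<infinity>\<close>.\<close>

lemma sum_elog_MInf:
  assumes "finite A" "i \<in> A" "h i \<le> 0"
  shows "(\<Sum>i\<in>A. elog (h i)) = - \<infinity>"
proof -
  have "elog x \<noteq> \<infinity>" for x by (simp add: elog_def)
  then have "(\<Sum>i\<in>A - {i}. elog (h i)) \<noteq> \<infinity>" using assms by (simp add: sum_Pinfty)
  then show ?thesis using assms by (subst sum.remove[of _ i]) (auto simp: elog_def)
qed

text \<open>If some \<open>y i\<close> is 0, the left side is \<open>- \<infinity>\<close>; this
  covers regions without a strictly dominating point. Otherwise all slopes are positive too, all
  logarithms are finite, and the comparison along positions carries over to
  \<open>\<Omega>\<close>.\<close>

lemma hull_slope_nash:
  fixes f :: "'a set \<Rightarrow> real" and y :: "'a \<Rightarrow> real"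
  assumes bij: "bij_betw \<rho> \<Omega> {..<n}"
    and F0: "F 0 = 0"
    and F: "\<And>k. k \<le> n \<Longrightarrow> (\<Sum>i\<in>initial_set \<Omega> \<rho> k. y i) \<le> F k"
    and y: "\<And>i. i \<in> \<Omega> \<Longrightarrow> y i \<ge> 0"
    and n: "n \<ge> 1"
    and nonneg: "hull_slope F n 0 \<ge> 0"
  shows "(\<Sum>i\<in>\<Omega>. elog (y i)) \<le> (\<Sum>i\<in>\<Omega>. elog (hull_slope F n (\<rho> i)))"
proof -
  have fin: "finite \<Omega>" using bij bij_betw_finite by blast
  define x where "x = hull_slope F n"
  have \<rho>: "\<rho> i < n" if "i \<in> \<Omega>" for i using bij that by (auto simp: bij_betw_def)
  consider "\<exists>i\<in>\<Omega>. y i = 0" | "\<And>i. i \<in> \<Omega> \<Longrightarrow> y i > 0"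
    using y by (metis order_le_less)
  then show ?thesis
  proof cases
    case 1
    then show ?thesis using sum_elog_MInf[OF fin, of _ y] by auto
  next
    case 2
    define \<sigma> where "\<sigma> = inv_into \<Omega> \<rho>"
    have \<sigma>: "\<sigma> (\<rho> i) = i" if "i \<in> \<Omega>" for i
      using that bij by (simp add: \<sigma>_def bij_betw_def)
    have sums: "(\<Sum>k<m. h (\<sigma> k)) = (\<Sum>i\<in>initial_set \<Omega> \<rho> m. h i)" if "m \<le> n"
      for m and h :: "'a \<Rightarrow> real"
      unfolding sum.reindex_bij_betw[OF bij_betw_initial_set[OF bij that], symmetric]
      by (intro sum.cong) (auto simp: initial_set_def \<sigma>)
    have In: "initial_set \<Omega> \<rho> n = \<Omega>" using \<rho> by (auto simp: initial_set_def)
    have pos\<sigma>: "y (\<sigma> k) > 0" if "k < n" for k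
      using that 2 bij by (metis \<sigma>_def bij_betw_def inv_into_into lessThan_iff)
    have "F k > 0" if "k \<le> n" "k > 0" for k
    proof -
      have "0 < (\<Sum>i<k. y (\<sigma> i))" using that pos\<sigma> by (intro sum_pos) auto
      then show ?thesis using F[OF that(1)] sums[OF that(1), of y] by simp
    qed
    moreover obtain k where "0 < k" "k \<le> n" "F k = lower_hull F n 0 + hull_slope F n 0 * real (k - 0)"
      using hull_slope_attained[of 0 n F] n by auto
    \<comment> \<open>The first slope is \<open>F k / k\<close> for some \<open>k > 0\<close>, hence
      not 0; convexity passes its positivity on to all later slopes.\<close>
    ultimately have "x 0 > 0" using nonneg by (simp add: x_def) (metis less_irrefl mult_eq_0_iff order_le_less)
    then have xpos: "x k > 0" if "k < n" for k
      using hull_slope_mono[of 0 k n F] that by (simp add: x_def)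
    have "(\<Sum>i\<in>\<Omega>. ln (y i)) = (\<Sum>k<n. ln (y (\<sigma> k)))"
      using sums[of n "\<lambda>i. ln (y i)"] In by simp
    also have "\<dots> \<le> (\<Sum>k<n. ln (x k))"
      unfolding x_def
      using xpos pos\<sigma> F sums by (intro hull_slope_maximizes_ln F0) (auto simp: x_def)
    also have "\<dots> = (\<Sum>i\<in>\<Omega>. ln (x (\<rho> i)))"
      by (rule sum.reindex_bij_betw[OF bij, symmetric])
    finally show ?thesis
      using 2 xpos \<rho> fin by (simp add: sum_elog_finite x_def)
  qed
qed

section \<open>The surplus of a generalized symmetric rank function\<close>

lemma concave_on_sum_inner_ge:
  fixes \<phi> :: "real \<Rightarrow> real"
  assumes "concave_on C \<phi>" "a \<in> C" "d \<in> C" "a \<le> b" "b \<le> d" "b + c = a + d"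
  shows "\<phi> a + \<phi> d \<le> \<phi> b + \<phi> c"
proof (cases "a = d")
  case False
  define t where "t = (b - a) / (d - a)"
  have t: "0 \<le> t" "t \<le> 1" using assms False by (auto simp: t_def divide_le_eq)
  have "t * (d - a) = b - a" using False by (simp add: t_def)
  \<comment> \<open>If \<open>b\<close> divides the segment from \<open>a\<close> to
    \<open>d\<close> at parameter \<open>t\<close>, equality of the sums puts \<open>c\<close> at
    \<open>1 - t\<close>. The two concavity inequalities then add up.\<close>
  then have b: "b = (1 - t) * a + t * d" and c: "c = (1 - (1 - t)) * a + (1 - t) * d"
    using assms(6) by (simp_all add: algebra_simps)
  have "\<phi> ((1 - t) *\<^sub>R a + t *\<^sub>R d) \<ge> (1 - t) * \<phi> a + t * \<phi> d"
    using concave_onD[OF assms(1) t assms(2,3)] .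
  moreover have "\<phi> ((1 - (1 - t)) *\<^sub>R a + (1 - t) *\<^sub>R d) \<ge> (1 - (1 - t)) * \<phi> a + (1 - t) * \<phi> d"
    using t by (intro concave_onD[OF assms(1) _ _ assms(2,3)]) auto
  ultimately have "(1 - t) * \<phi> a + t * \<phi> d + (t * \<phi> a + (1 - t) * \<phi> d) \<le> \<phi> b + \<phi> c"
    unfolding b c by simp
  then show ?thesis by (simp add: algebra_simps)
qed (use assms in simp)

definition bargaining_surplus :: "'a set \<Rightarrow> ('a set \<Rightarrow> real) \<Rightarrow> 'a set \<Rightarrow> real" where
  "bargaining_surplus \<Omega> g S = g S - (\<Sum>i\<in>S. canonical_disagreement \<Omega> g i)"

lemma bargaining_surplus_submodular:
  assumes "rank_function \<Omega> g" "finite \<Omega>" "S \<subseteq> \<Omega>" "T \<subseteq> \<Omega>"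
  shows "bargaining_surplus \<Omega> g (S \<inter> T) + bargaining_surplus \<Omega> g (S \<union> T)
    \<le> bargaining_surplus \<Omega> g S + bargaining_surplus \<Omega> g T"
proof -
  have "g (S \<inter> T) + g (S \<union> T) \<le> g S + g T"
    using assms by (auto simp: rank_function_def)
  moreover have "sum h (S \<union> T) + sum h (S \<inter> T) = sum h S + sum h T" for h :: "'a \<Rightarrow> real"
    using assms by (intro sum.union_inter) (auto intro: finite_subset)
  ultimately show ?thesis unfolding bargaining_surplus_def
    by (smt (verit, best))
qed

text \<open>By submodularity, adding \<open>i\<close> to \<open>S\<close> raises \<open>g\<close> by
  at least as much as adding it to \<open>\<Omega> - {i}\<close>, which is the disagreement value of
  \<open>i\<close>. So the surplus starts at 0 and never falls.\<close>

lemma bargaining_surplus_nonneg: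
  assumes g: "rank_function \<Omega> g" and "finite \<Omega>" "S \<subseteq> \<Omega>"
  shows "bargaining_surplus \<Omega> g S \<ge> 0"
proof -
  have "finite S" using assms finite_subset by blast
  then show ?thesis using \<open>S \<subseteq> \<Omega>\<close>
  proof (induction S rule: finite_induct)
    case empty
    then show ?case using g by (simp add: bargaining_surplus_def rank_function_def)
  next
    case (insert i S)
    have "insert i S \<inter> (\<Omega> - {i}) = S" "insert i S \<union> (\<Omega> - {i}) = \<Omega>"
      using insert by auto
    moreover have "g (insert i S \<inter> (\<Omega> - {i})) + g (insert i S \<union> (\<Omega> - {i}))
        \<le> g (insert i S) + g (\<Omega> - {i})"
      using g insert.prems unfolding rank_function_def by (metis Diff_subset)
    ultimately show ?case
      using insert by (simp add: bargaining_surplus_def canonical_disagreement_def)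
  qed
qed

lemma bargaining_surplus_exchange:
  assumes gs: "generalized_symmetric \<Omega> P \<phi> g" and fin: "finite \<Omega>"
    and S: "S \<subseteq> \<Omega>" "i \<in> S" "j \<in> \<Omega> - S" and le: "P j \<le> P i"
  shows "bargaining_surplus \<Omega> g (insert j (S - {i})) \<le> bargaining_surplus \<Omega> g S"
proof -
  define R where "R = S - {i}"
  define W where "W = sum P \<Omega>"
  have nn: "\<And>i. i \<in> \<Omega> \<Longrightarrow> P i \<ge> 0" and conc: "concave_on {0..} \<phi>"
    and g: "\<And>S. S \<subseteq> \<Omega> \<Longrightarrow> g S = \<phi> (sum P S)"
    using gs by (auto simp: generalized_symmetric_def)
  have R: "R \<subseteq> \<Omega>" "finite R" "i \<notin> R" "j \<notin> R" "S = insert i R" "i \<in> \<Omega>" "j \<in> \<Omega>" "i \<noteq> j"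
    using S fin finite_subset by (auto simp: R_def)
  have "sum P (insert i (insert j R)) \<le> W"
    unfolding W_def using R nn fin by (intro sum_mono2) auto
  then have W: "sum P R + P i + P j \<le> W" using R by simp
  have R0: "sum P R \<ge> 0" using R nn by (intro sum_nonneg) auto
  \<comment> \<open>In the claim \<open>\<phi> W\<close> cancels from the two disagreement values,
    leaving this inequality. The outer arguments are \<open>sum P R + P j\<close> and
    \<open>W - P j\<close>; the latter is at least \<open>sum P R + P i\<close> because
    \<open>i\<close> and \<open>j\<close> are distinct and outside \<open>R\<close>.\<close>
  have "\<phi> (sum P R + P j) + \<phi> (W - P j) \<le> \<phi> (sum P R + P i) + \<phi> (W - P i)"
    using W R0 nn[of i] nn[of j] R le by (intro concave_on_sum_inner_ge[OF conc]) auto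
  moreover have "g (insert j R) = \<phi> (sum P R + P j)" "g (insert i R) = \<phi> (sum P R + P i)"
    using R by (simp_all add: g add.commute)
  moreover have "g (\<Omega> - {k}) = \<phi> (W - P k)" if "k \<in> \<Omega>" for k
    using that fin by (simp add: g W_def sum_diff1)
  ultimately show ?thesis
    using R unfolding R_def[symmetric] by (simp add: bargaining_surplus_def canonical_disagreement_def)
qed

text \<open>A different set of the same size has an element outside the initial set and misses one
  inside it. Exchanging the two does not raise the surplus and shrinks the difference from the
  initial set, the induction measure.\<close>

lemma bargaining_surplus_initial_set_le:
  assumes gs: "generalized_symmetric \<Omega> P \<phi> g"
    and bij: "bij_betw \<rho> \<Omega> {..<n}"
    and mono: "\<And>i j. i \<in> \<Omega> \<Longrightarrow> j \<in> \<Omega> \<Longrightarrow> \<rho> j \<le> \<rho> i \<Longrightarrow> P j \<le> P i"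
    and S: "S \<subseteq> \<Omega>"
  shows "bargaining_surplus \<Omega> g (initial_set \<Omega> \<rho> (card S)) \<le> bargaining_surplus \<Omega> g S"
proof -
  have fin: "finite \<Omega>" using bij bij_betw_finite by blast
  define k where "k = card S"
  have k: "k \<le> n" using card_mono[OF fin S] bij_betw_same_card[OF bij] by (simp add: k_def)
  let ?I = "initial_set \<Omega> \<rho> k"
  have I: "?I \<subseteq> \<Omega>" "card ?I = k"
    using card_initial_set[OF bij k] by (auto simp: initial_set_def)
  have "card S = k \<Longrightarrow> bargaining_surplus \<Omega> g ?I \<le> bargaining_surplus \<Omega> g S"
    using S
  proof (induction "card (S - ?I)" arbitrary: S rule: less_induct)
    case less
    have finS: "finite S" "finite ?I" using less.prems I fin finite_subset by blast+
    show ?case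
    proof (cases "S = ?I")
      case False
      then have "\<not> S \<subseteq> ?I" "\<not> ?I \<subseteq> S"
        using card_subset_eq[OF finS(2), of S] card_subset_eq[OF finS(1), of ?I] I less.prems by auto
      then obtain i j where ij: "i \<in> S" "i \<notin> ?I" "j \<in> ?I" "j \<notin> S" by blast
      then have P: "P j \<le> P i"
        using less.prems by (intro mono) (auto simp: initial_set_def)
      define T where "T = insert j (S - {i})"
      have "card T = k" "T \<subseteq> \<Omega>"
        using ij finS less.prems I card_Suc_Diff1[OF finS(1) ij(1)] by (auto simp: T_def)
      moreover have "T - ?I \<subset> S - ?I" using ij by (auto simp: T_def)
      then have "card (T - ?I) < card (S - ?I)" using finS by (intro psubset_card_mono) auto
      ultimately have "bargaining_surplus \<Omega> g ?I \<le> bargaining_surplus \<Omega> g T"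
        using less.hyps by blast
      also have "\<dots> \<le> bargaining_surplus \<Omega> g S"
        unfolding T_def using ij P less.prems I by (intro bargaining_surplus_exchange[OF gs fin]) auto
      finally show ?thesis .
    qed simp
  qed
  then show ?thesis by (simp add: k_def)
qed

text \<open>The assumption \<open>mono\<close> says that \<open>\<rho>\<close> sorts by
  \<open>P\<close>, so \<open>F k\<close> is the least surplus of a set of size \<open>k\<close>.
  Then \<open>hull_slope_feasible\<close> gives feasibility, and \<open>hull_slope_nash\<close>,
  applied to \<open>y - d\<close> for a competitor \<open>y\<close>, gives optimality.\<close>

lemma nash_bargaining_solution_hull:
  assumes rank: "rank_function \<Omega> g" and gs: "generalized_symmetric \<Omega> P \<phi> g"
    and bij: "bij_betw \<rho> \<Omega> {..<n}" and n: "n \<ge> 1"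
    and mono: "\<And>i j. i \<in> \<Omega> \<Longrightarrow> j \<in> \<Omega> \<Longrightarrow> \<rho> j \<le> \<rho> i \<Longrightarrow> P j \<le> P i"
    and F: "\<And>k. k \<le> n \<Longrightarrow> F k = bargaining_surplus \<Omega> g (initial_set \<Omega> \<rho> k)"
  shows "nash_bargaining_solution \<Omega> (polymatroid \<Omega> g) (canonical_disagreement \<Omega> g)
    (\<lambda>i\<in>\<Omega>. canonical_disagreement \<Omega> g i + hull_slope F n (\<rho> i))"
proof -
  define d where "d = canonical_disagreement \<Omega> g"
  define f where "f = bargaining_surplus \<Omega> g"
  define r where "r = (\<lambda>i\<in>\<Omega>. d i + hull_slope F n (\<rho> i))"
  have fin: "finite \<Omega>" using bij bij_betw_finite by blast
  have f_def': "f S = g S - sum d S" for S by (simp add: f_def bargaining_surplus_def d_def)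
  have I: "initial_set \<Omega> \<rho> k \<subseteq> \<Omega>" for k by (auto simp: initial_set_def)
  have f0: "f {} = 0" using rank by (simp add: f_def' rank_function_def)
  have F0: "F 0 = 0" using F[of 0] f0 by (simp add: f_def initial_set_def)
  have feas: "(\<Sum>i\<in>S. hull_slope F n (\<rho> i)) \<le> f S" if "S \<subseteq> \<Omega>" for S
  proof (rule hull_slope_feasible[where f = f and F = F, OF bij _ f0 _ _ that])
    show "f (S \<inter> T) + f (S \<union> T) \<le> f S + f T" if "S \<subseteq> \<Omega>" "T \<subseteq> \<Omega>" for S T
      unfolding f_def using bargaining_surplus_submodular[OF rank fin that] .
    show "F (card S) \<le> f S" if "S \<subseteq> \<Omega>" for S
      using bargaining_surplus_initial_set_le[OF gs bij mono that] F[of "card S"]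
        card_mono[OF fin that] bij_betw_same_card[OF bij] by (simp add: f_def)
    show "F k = f (initial_set \<Omega> \<rho> k)" if "k \<le> n" for k
      using F[OF that] by (simp add: f_def)
  qed
  have slope0: "hull_slope F n 0 \<ge> 0"
  proof -
    obtain k where k: "0 < k" "k \<le> n" "F k = lower_hull F n 0 + hull_slope F n 0 * real (k - 0)"
      using hull_slope_attained[of 0 n F] n by auto
    have "F k \<ge> 0"
      using F[OF k(2)] bargaining_surplus_nonneg[OF rank fin I] by simp
    with k show ?thesis by (simp add: zero_le_mult_iff)
  qed
  have slope: "hull_slope F n (\<rho> i) \<ge> 0" if "i \<in> \<Omega>" for i
    using hull_slope_mono[of 0 "\<rho> i" n F] slope0 that bij by (force simp: bij_betw_def)
  have d: "d i \<ge> 0" if "i \<in> \<Omega>" for i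
    using rank that by (simp add: d_def canonical_disagreement_def rank_function_def)
  have r_sum: "sum r S = sum d S + (\<Sum>i\<in>S. hull_slope F n (\<rho> i))" if "S \<subseteq> \<Omega>" for S
    unfolding sum.distrib[symmetric] using that by (intro sum.cong) (auto simp: r_def)
  have "sum r S \<le> g S" if "S \<subseteq> \<Omega>" for S
    using feas[OF that] r_sum[OF that] by (simp add: f_def')
  then have "r \<in> polymatroid \<Omega> g"
    using d slope by (auto simp: polymatroid_def r_def)
  moreover have "r i \<ge> d i" if "i \<in> \<Omega>" for i using slope that by (simp add: r_def)
  moreover have "(\<Sum>i\<in>\<Omega>. elog (y i - d i)) \<le> (\<Sum>i\<in>\<Omega>. elog (r i - d i))"
    if y: "y \<in> polymatroid \<Omega> g" "\<forall>i\<in>\<Omega>. y i \<ge> d i" for y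
  proof -
    have "(\<Sum>i\<in>\<Omega>. elog (y i - d i)) \<le> (\<Sum>i\<in>\<Omega>. elog (hull_slope F n (\<rho> i)))"
    proof (rule hull_slope_nash[where F = F, OF bij F0 _ _ n slope0])
      show "(\<Sum>i\<in>initial_set \<Omega> \<rho> k. y i - d i) \<le> F k" if "k \<le> n" for k
        using y(1) I[of k] F[OF that]
        by (simp add: polymatroid_def sum_subtractf bargaining_surplus_def d_def)
    qed (use y in auto)
    also have "\<dots> = (\<Sum>i\<in>\<Omega>. elog (r i - d i))" by (simp add: r_def)
    finally show ?thesis .
  qed
  ultimately show ?thesis
    unfolding nash_bargaining_solution_def is_arg_max_def d_def[symmetric] r_def[symmetric]
    using not_less by blast
qed

section \<open>Cost-aware weakest preconditions\<close>

text \<open>The elapsed time is an argument of the postcondition, so termination, correctness and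
  running time are derived together.\<close>

definition wp :: "(real \<Rightarrow> real) \<Rightarrow> com \<Rightarrow> (nat \<Rightarrow> store \<Rightarrow> bool) \<Rightarrow> store \<Rightarrow> bool" where
  "wp \<phi> c Q s \<longleftrightarrow> (\<exists>t s'. exec \<phi> c s t s' \<and> Q t s')"

lemma wp_mono: "wp \<phi> c Q s \<Longrightarrow> (\<And>t s'. Q t s' \<Longrightarrow> R t s') \<Longrightarrow> wp \<phi> c R s"
  unfolding wp_def by blast

lemma wp_Skip [simp]: "wp \<phi> Skip Q = Q 1"
  unfolding wp_def by (rule ext) (metis exec.Skip exec_SkipE)

lemma wp_NAssign [simp]:
  "wp \<phi> (NAssign a i x) Q =
    (\<lambda>s. Q (ncost i + ncost x + 1) (nats_put a (nval s i) (nval s x) s))"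
  unfolding wp_def by (rule ext) (metis exec.NAssign exec_NAssignE)

lemma wp_RAssign [simp]:
  "wp \<phi> (RAssign a i x) Q =
    (\<lambda>s. Q (ncost i + rcost x + 1) (reals_put a (nval s i) (rval \<phi> s x) s))"
  unfolding wp_def by (rule ext) (metis exec.RAssign exec_RAssignE)

lemma wp_Seq [simp]:
  "wp \<phi> (Seq c d) Q = wp \<phi> c (\<lambda>t. wp \<phi> d (\<lambda>u. Q (t + u + 1)))"
proof (intro ext iffI)
  fix s
  assume "wp \<phi> (Seq c d) Q s"
  then obtain t s' where "exec \<phi> (Seq c d) s t s'" "Q t s'" unfolding wp_def by blast
  then show "wp \<phi> c (\<lambda>t. wp \<phi> d (\<lambda>u. Q (t + u + 1))) s"
    unfolding wp_def by (elim exec_SeqE) auto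
next
  fix s
  assume "wp \<phi> c (\<lambda>t. wp \<phi> d (\<lambda>u. Q (t + u + 1))) s"
  then obtain t s' u s'' where "exec \<phi> c s t s'" "exec \<phi> d s' u s''" "Q (t + u + 1) s''"
    unfolding wp_def by blast
  then show "wp \<phi> (Seq c d) Q s" unfolding wp_def using exec.Seq by blast
qed

lemma wp_Cond [simp]:
  "wp \<phi> (Cond b c d) Q =
    (\<lambda>s. wp \<phi> (if bval \<phi> s b then c else d) (\<lambda>t. Q (bcost b + t + 1)) s)"
proof (intro ext iffI)
  fix s
  assume "wp \<phi> (Cond b c d) Q s"
  then obtain t s' where "exec \<phi> (Cond b c d) s t s'" "Q t s'" unfolding wp_def by blast
  then show "wp \<phi> (if bval \<phi> s b then c else d) (\<lambda>t. Q (bcost b + t + 1)) s"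
    unfolding wp_def by (elim exec_CondE) auto
next
  fix s
  assume "wp \<phi> (if bval \<phi> s b then c else d) (\<lambda>t. Q (bcost b + t + 1)) s"
  then obtain t s' where *: "exec \<phi> (if bval \<phi> s b then c else d) s t s'" "Q (bcost b + t + 1) s'"
    unfolding wp_def by blast
  then have "exec \<phi> (Cond b c d) s (bcost b + t + 1) s'"
    using exec.CondTrue exec.CondFalse by (cases "bval \<phi> s b") simp_all
  with *(2) show "wp \<phi> (Cond b c d) Q s" unfolding wp_def by blast
qed

text \<open>Loops get introduction rules only, since a rewrite rule would reproduce the loop on its
  right-hand side.\<close>

lemma wp_LoopFalse: "\<not> bval \<phi> s b \<Longrightarrow> Q (bcost b + 1) s \<Longrightarrow> wp \<phi> (Loop b c) Q s"
  unfolding wp_def by (blast intro: exec.LoopFalse)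

lemma wp_LoopTrue:
  "bval \<phi> s b \<Longrightarrow> wp \<phi> c (\<lambda>t. wp \<phi> (Loop b c) (\<lambda>u. Q (bcost b + t + u + 1))) s \<Longrightarrow>
    wp \<phi> (Loop b c) Q s"
  unfolding wp_def by (blast intro: exec.LoopTrue)

lemma nats_nats_put [simp]:
  "nats (nats_put a i v s) b = (if b = a then (nats s a)(i := v) else nats s b)"
  by (simp add: nats_put_def)

lemma reals_nats_put [simp]: "reals (nats_put a i v s) = reals s"
  by (simp add: nats_put_def)

lemma reals_reals_put [simp]:
  "reals (reals_put a i v s) b = (if b = a then (reals s a)(i := v) else reals s b)"
  by (simp add: reals_put_def)

lemma nats_reals_put [simp]: "nats (reals_put a i v s) = nats s"
  by (simp add: reals_put_def)

text \<open>Scalar variables are cells 0 of their arrays; every loop ends at the input size.\<close>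

abbreviation nvar :: "nat \<Rightarrow> nexp" where "nvar v \<equiv> NGet v (NConst 0)"
abbreviation rvar :: "nat \<Rightarrow> rexp" where "rvar v \<equiv> RGet v (NConst 0)"

definition for_loop :: "nat \<Rightarrow> nexp \<Rightarrow> com \<Rightarrow> com" where
  "for_loop v lo c =
     Seq (NAssign v (NConst 0) lo)
       (Loop (BNot (NLess (nvar 0) (nvar v)))
         (Seq c (NAssign v (NConst 0) (NPlus (nvar v) (NConst 1)))))"

text \<open>\<open>I i\<close> describes the store before round \<open>i\<close>, with the counter
  already set. A round costs 14 beyond its body: 6 for the guard, 6 for the increment, 1 each for
  the loop and the sequence. The final test costs 7, the initialisation \<open>ncost lo + 2\<close>,
  the outer sequence 1.\<close>

lemma wp_for_loop:
  assumes start: "1 \<le> nval s lo" "nval s lo \<le> Suc n" "I (nval s lo) (nats_put v 0 (nval s lo) s)"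
    and inv: "\<And>i s. I i s \<Longrightarrow> nats s 0 0 = n \<and> nats s v 0 = i"
    and step: "\<And>i s. 1 \<le> i \<Longrightarrow> i \<le> n \<Longrightarrow> I i s \<Longrightarrow>
      wp \<phi> c (\<lambda>t s'. t \<le> B \<and> nats s' v 0 = i \<and> I (Suc i) (nats_put v 0 (Suc i) s')) s"
    and post: "\<And>t s'. t \<le> n * (B + 14) + ncost lo + 10 \<Longrightarrow> I (Suc n) s' \<Longrightarrow> Q t s'"
  shows "wp \<phi> (for_loop v lo c) Q s"
proof -
  let ?L = "Loop (BNot (NLess (nvar 0) (nvar v)))
    (Seq c (NAssign v (NConst 0) (NPlus (nvar v) (NConst 1))))"
  \<comment> \<open>Here \<open>k\<close> counts the remaining rounds, so the counter is
    \<open>Suc n - k\<close>.\<close>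
  have loop: "wp \<phi> ?L (\<lambda>t s'. t \<le> k * (B + 14) + 7 \<and> I (Suc n) s') s"
    if "I (Suc n - k) s" "k \<le> n" for k s
    using that
  proof (induction k arbitrary: s)
    case 0
    then show ?case using inv[OF 0(1)] by (intro wp_LoopFalse) simp_all
  next
    case (Suc k)
    define i where "i = n - k"
    have i: "1 \<le> i" "i \<le> n" "Suc i = Suc n - k" "I i s"
      using Suc.prems by (auto simp: i_def)
    have "wp \<phi> c (\<lambda>t s'. wp \<phi> ?L
        (\<lambda>u s'. t + u + 14 \<le> Suc k * (B + 14) + 7 \<and> I (Suc n) s')
        (nats_put v 0 (Suc (nats s' v 0)) s')) s"
    proof (rule wp_mono[OF step[OF i(1,2,4)]])
      fix t s'
      assume *: "t \<le> B \<and> nats s' v 0 = i \<and> I (Suc i) (nats_put v 0 (Suc i) s')"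
      then have "wp \<phi> ?L (\<lambda>t s'. t \<le> k * (B + 14) + 7 \<and> I (Suc n) s') (nats_put v 0 (Suc i) s')"
        using Suc.IH[of "nats_put v 0 (Suc i) s'"] i(3) Suc.prems by simp
      then show "wp \<phi> ?L (\<lambda>u s'. t + u + 14 \<le> Suc k * (B + 14) + 7 \<and> I (Suc n) s')
          (nats_put v 0 (Suc (nats s' v 0)) s')"
        using * by (auto elim!: wp_mono)
    qed
    then show ?case
      using inv[OF i(4)] i(2) by (intro wp_LoopTrue) (simp_all add: algebra_simps)
  qed
  have "wp \<phi> ?L (\<lambda>t s'. t \<le> n * (B + 14) + 7 \<and> I (Suc n) s') (nats_put v 0 (nval s lo) s)"
  proof (rule wp_mono[OF loop[of "Suc n - nval s lo"]])
    fix t s'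
    assume t: "t \<le> (Suc n - nval s lo) * (B + 14) + 7 \<and> I (Suc n) s'"
    have "(Suc n - nval s lo) * (B + 14) \<le> n * (B + 14)"
      using start(1) by (intro mult_le_mono1) simp
    with t show "t \<le> n * (B + 14) + 7 \<and> I (Suc n) s'" by linarith
  qed (use start in auto)
  then show ?thesis
    unfolding for_loop_def by (auto elim!: wp_mono intro: post)
qed

section \<open>The algorithm\<close>

text \<open>A frame condition by whole arrays: \<open>N\<close> and \<open>R\<close> list those that
  a phase may write, so earlier results elsewhere survive it.\<close>

definition unchanged :: "nat set \<Rightarrow> nat set \<Rightarrow> store \<Rightarrow> store \<Rightarrow> bool" where
  "unchanged N R s s' \<longleftrightarrow>
    (\<forall>a. a \<notin> N \<longrightarrow> nats s' a = nats s a) \<and> (\<forall>a. a \<notin> R \<longrightarrow> reals s' a = reals s a)"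

section \<open>Sorting positions by counting predecessors\<close>

definition predecessors :: "(nat \<Rightarrow> real) \<Rightarrow> nat \<Rightarrow> nat \<Rightarrow> nat set" where
  "predecessors P m i = {j \<in> {1..<m}. P j \<le> P i \<and> (P j < P i \<or> j \<le> i)}"

text \<open>Ties in \<open>P\<close> are broken by the index, which makes the order total. Each
  element of \<open>{1..n}\<close> is among its own predecessors, so subtracting 1 lets positions
  start at 0.\<close>

definition position :: "(nat \<Rightarrow> real) \<Rightarrow> nat \<Rightarrow> nat \<Rightarrow> nat" where
  "position P n i = card (predecessors P (Suc n) i) - 1"

lemma finite_predecessors [simp]: "finite (predecessors P m i)"
  by (simp add: predecessors_def)

lemma predecessors_1 [simp]: "predecessors P (Suc 0) i = {}"
  by (simp add: predecessors_def)

text \<open>The bound \<open>m\<close> follows the counter of the scan: a round adds at most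
  \<open>m\<close>, under the condition that \<open>scan_prog\<close> tests.\<close>

lemma predecessors_Suc:
  assumes "1 \<le> m"
  shows "predecessors P (Suc m) i =
    (if P m \<le> P i \<and> (P m < P i \<or> m \<le> i) then insert m (predecessors P m i)
     else predecessors P m i)"
  using assms by (auto simp: predecessors_def less_Suc_eq)

lemma notin_predecessors [simp]: "m \<notin> predecessors P m i"
  by (simp add: predecessors_def)

lemma card_predecessors:
  assumes "i \<in> {1..n}"
  shows "card (predecessors P (Suc n) i) = Suc (position P n i)"
proof -
  have "i \<in> predecessors P (Suc n) i" using assms by (auto simp: predecessors_def)
  then have "card (predecessors P (Suc n) i) > 0" by (auto simp: card_gt_0_iff)
  then show ?thesis by (simp add: position_def)
qed

lemma mem_predecessors:
  "k \<in> predecessors P (Suc n) i \<longleftrightarrow> k \<in> {1..n} \<and> (P k < P i \<or> P k = P i \<and> k \<le> i)"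
  by (auto simp: predecessors_def)

lemma predecessors_mono:
  assumes "j \<in> predecessors P (Suc n) i"
  shows "predecessors P (Suc n) j \<subseteq> predecessors P (Suc n) i"
proof
  fix k assume "k \<in> predecessors P (Suc n) j"
  with assms show "k \<in> predecessors P (Suc n) i"
    unfolding mem_predecessors by (metis less_trans order_trans)
qed

text \<open>Predecessor sets form a chain. If \<open>j\<close> is not a predecessor of
  \<open>i\<close>, then \<open>i\<close> is one of \<open>j\<close>, and the inclusion is strict
  because \<open>j\<close> belongs to its own predecessors.\<close>

lemma position_le_iff:
  assumes "i \<in> {1..n}" "j \<in> {1..n}"
  shows "position P n j \<le> position P n i \<longleftrightarrow> j \<in> predecessors P (Suc n) i"
proof
  assume "j \<in> predecessors P (Suc n) i"
  then have "card (predecessors P (Suc n) j) \<le> card (predecessors P (Suc n) i)"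
    by (intro card_mono predecessors_mono) simp_all
  then show "position P n j \<le> position P n i" by (simp add: position_def)
next
  assume le: "position P n j \<le> position P n i"
  show "j \<in> predecessors P (Suc n) i"
  proof (rule ccontr)
    assume *: "j \<notin> predecessors P (Suc n) i"
    then have "i \<in> predecessors P (Suc n) j"
      using assms unfolding mem_predecessors by (metis linorder_neqE nat_le_linear)
    moreover have "j \<in> predecessors P (Suc n) j" using assms by (simp add: mem_predecessors)
    ultimately have "predecessors P (Suc n) i \<subset> predecessors P (Suc n) j"
      using * predecessors_mono by blast
    then have "card (predecessors P (Suc n) i) < card (predecessors P (Suc n) j)"
      by (intro psubset_card_mono) simp_all
    with le show False using card_predecessors[OF assms(1)] card_predecessors[OF assms(2)] by simp
  qed
qed

lemma bij_betw_position: "bij_betw (position P n) {1..n} {..<n}"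
proof -
  have "inj_on (position P n) {1..n}"
  proof (rule inj_onI)
    fix i j assume "i \<in> {1..n}" "j \<in> {1..n}" "position P n i = position P n j"
    then have "i \<in> predecessors P (Suc n) j" "j \<in> predecessors P (Suc n) i"
      using position_le_iff[of i n j P] position_le_iff[of j n i P] by auto
    then show "i = j" by (auto simp: predecessors_def)
  qed
  moreover have "position P n ` {1..n} \<subseteq> {..<n}"
  proof safe
    fix i assume i: "i \<in> {1..n}"
    have "card (predecessors P (Suc n) i) \<le> card {1..n}"
      by (intro card_mono) (auto simp: predecessors_def)
    then show "position P n i < n" using i card_predecessors by simp
  qed
  ultimately show ?thesis
    by (metis bij_betw_def card_atLeastAtMost card_image card_lessThan card_subset_eq
        diff_Suc_1 finite_lessThan)
qed

text \<open>This turns the sums over predecessors, which the scan computes, into the surplus of an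
  initial set.\<close>

lemma predecessors_eq_initial_set:
  assumes "i \<in> {1..n}"
  shows "predecessors P (Suc n) i = initial_set {1..n} (position P n) (Suc (position P n i))"
  using position_le_iff[OF assms]
  by (auto simp: initial_set_def less_Suc_eq_le) (auto simp: predecessors_def)

section \<open>The phases of the program and their costs\<close>

text \<open>
  Arrays of naturals: 1 and 2 are the loop counters, 3 is the number of predecessors of the current
  element, 4 holds the positions, counted from 1. Arrays of reals: 2 is the sum of all \<open>P i\<close>, 3 the
  disagreement point, 4 and 5 sum \<open>P\<close> and \<open>d\<close> over the predecessors of the current element, 6 is \<open>F\<close>,
  7 the current value of the minorant, 8 and 9 the current minimum and the denominator in its
  computation, and 10 the slopes.
\<close>

definition sum_prog :: com where
  "sum_prog = for_loop 1 (NConst 1)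
     (RAssign 2 (NConst 0) (RPlus (rvar 2) (RGet 0 (nvar 1))))"

lemma wp_sum_prog:
  assumes "nats s 0 0 = n" "reals s 2 0 = 0"
  shows "wp \<phi> sum_prog (\<lambda>t s'. t \<le> n * 100 + 100 \<and> unchanged {1} {2} s s' \<and>
    reals s' 2 0 = sum (reals s 0) {1..n}) s"
  unfolding sum_prog_def
proof (rule wp_for_loop[where n = n and B = 20 and I = "\<lambda>i s'. nats s' 1 0 = i \<and>
      unchanged {1} {2} s s' \<and> reals s' 2 0 = sum (reals s 0) {1..<i}"])
qed (use assms in \<open>auto simp: unchanged_def simp flip: atLeastLessThanSuc_atLeastAtMost\<close>)

definition disagreement_prog :: com where
  "disagreement_prog = for_loop 1 (NConst 1)
     (RAssign 3 (nvar 1)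
       (RMinus (Oracle (rvar 2)) (Oracle (RMinus (rvar 2) (RGet 0 (nvar 1))))))"

lemma wp_disagreement_prog:
  assumes "nats s 0 0 = n"
  shows "wp \<phi> disagreement_prog (\<lambda>t s'. t \<le> n * 100 + 100 \<and> unchanged {1} {3} s s' \<and>
    (\<forall>i\<in>{1..n}. reals s' 3 i = \<phi> (reals s 2 0) - \<phi> (reals s 2 0 - reals s 0 i))) s"
  unfolding disagreement_prog_def
proof (rule wp_for_loop[where n = n and B = 20 and I = "\<lambda>i s'. nats s' 1 0 = i \<and>
      unchanged {1} {3} s s' \<and>
      (\<forall>j\<in>{1..<i}. reals s' 3 j = \<phi> (reals s 2 0) - \<phi> (reals s 2 0 - reals s 0 j))"])
qed (use assms in \<open>auto simp: unchanged_def less_Suc_eq\<close>)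

definition scan_prog :: com where
  "scan_prog = for_loop 2 (NConst 1)
     (Cond (BAnd (BNot (RLess (RGet 0 (nvar 1)) (RGet 0 (nvar 2))))
             (BNot (BAnd (BNot (RLess (RGet 0 (nvar 2)) (RGet 0 (nvar 1))))
                (NLess (nvar 1) (nvar 2)))))
       (Seq (NAssign 3 (NConst 0) (NPlus (nvar 3) (NConst 1)))
         (Seq (RAssign 4 (NConst 0) (RPlus (rvar 4) (RGet 0 (nvar 2))))
           (RAssign 5 (NConst 0) (RPlus (rvar 5) (RGet 3 (nvar 2))))))
       Skip)"

lemma wp_scan_prog:
  assumes "nats s 0 0 = n" "nats s 1 0 = i" "nats s 3 0 = 0" "reals s 4 0 = 0" "reals s 5 0 = 0"
  shows "wp \<phi> scan_prog (\<lambda>t s'. t \<le> n * 100 + 100 \<and> unchanged {2, 3} {4, 5} s s' \<and>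
    nats s' 3 0 = card (predecessors (reals s 0) (Suc n) i) \<and>
    reals s' 4 0 = sum (reals s 0) (predecessors (reals s 0) (Suc n) i) \<and>
    reals s' 5 0 = sum (reals s 3) (predecessors (reals s 0) (Suc n) i)) s"
  unfolding scan_prog_def
proof (rule wp_for_loop[where n = n and B = 60 and I = "\<lambda>j s'. nats s' 2 0 = j \<and>
    unchanged {2, 3} {4, 5} s s' \<and>
    nats s' 3 0 = card (predecessors (reals s 0) j i) \<and>
    reals s' 4 0 = sum (reals s 0) (predecessors (reals s 0) j i) \<and>
    reals s' 5 0 = sum (reals s 3) (predecessors (reals s 0) j i)"])
qed (use assms in \<open>auto simp: unchanged_def predecessors_Suc not_less\<close>)

text \<open>No data are moved: each element writes its own value of \<open>F\<close>, so array 6 is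
  filled out of order. The predecessor count itself is the index, which puts \<open>F k\<close> into
  cell \<open>k\<close>.\<close>

definition order_prog :: com where
  "order_prog = for_loop 1 (NConst 1)
     (Seq (NAssign 3 (NConst 0) (NConst 0))
       (Seq (RAssign 4 (NConst 0) (RConst 0))
         (Seq (RAssign 5 (NConst 0) (RConst 0))
           (Seq scan_prog
             (Seq (NAssign 4 (nvar 1) (nvar 3))
               (RAssign 6 (nvar 3) (RMinus (Oracle (rvar 4)) (rvar 5))))))))"

lemma wp_order_prog:
  assumes "nats s 0 0 = n"
    and F: "\<And>i. i \<in> {1..n} \<Longrightarrow> F (Suc (position (reals s 0) n i)) =
      \<phi> (sum (reals s 0) (predecessors (reals s 0) (Suc n) i))
        - sum (reals s 3) (predecessors (reals s 0) (Suc n) i)"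
  shows "wp \<phi> order_prog (\<lambda>t s'. t \<le> n * (n * 100 + 200) + 100 \<and>
    unchanged {1, 2, 3, 4} {4, 5, 6} s s' \<and>
    (\<forall>i\<in>{1..n}. nats s' 4 i = Suc (position (reals s 0) n i)) \<and>
    (\<forall>k\<in>{1..n}. reals s' 6 k = F k)) s"
  unfolding order_prog_def
proof (rule wp_for_loop[where n = n and B = "n * 100 + 150" and I = "\<lambda>i s'. nats s' 1 0 = i \<and>
    unchanged {1, 2, 3, 4} {4, 5, 6} s s' \<and>
    (\<forall>j\<in>{1..<i}. nats s' 4 j = Suc (position (reals s 0) n j) \<and>
      reals s' 6 (Suc (position (reals s 0) n j)) = F (Suc (position (reals s 0) n j)))"])
  fix i s1
  assume i: "1 \<le> i" "i \<le> n" and I: "nats s1 1 0 = i \<and>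
    unchanged {1, 2, 3, 4} {4, 5, 6} s s1 \<and>
    (\<forall>j\<in>{1..<i}. nats s1 4 j = Suc (position (reals s 0) n j) \<and>
      reals s1 6 (Suc (position (reals s 0) n j)) = F (Suc (position (reals s 0) n j)))"
  define s2 where "s2 = reals_put 5 0 0 (reals_put 4 0 0 (nats_put 3 0 0 s1))"
  have same: "reals s2 0 = reals s 0" "reals s2 3 = reals s 3" "nats s2 0 0 = n"
    using I assms(1) by (simp_all add: s2_def unchanged_def)
  have card: "card (predecessors (reals s 0) (Suc n) i) = Suc (position (reals s 0) n i)"
    using i by (intro card_predecessors) auto
  have scan: "wp \<phi> scan_prog (\<lambda>t s'. t \<le> n * 100 + 100 \<and> unchanged {2, 3} {4, 5} s2 s' \<and>
    nats s' 3 0 = Suc (position (reals s 0) n i) \<and>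
    \<phi> (reals s' 4 0) - reals s' 5 0 = F (Suc (position (reals s 0) n i))) s2"
    by (rule wp_mono[OF wp_scan_prog[of s2 n i]])
      (use same card F[of i] i I in \<open>auto simp: s2_def\<close>)
  show "wp \<phi> (Seq (NAssign 3 (NConst 0) (NConst 0))
       (Seq (RAssign 4 (NConst 0) (RConst 0))
         (Seq (RAssign 5 (NConst 0) (RConst 0))
           (Seq scan_prog
             (Seq (NAssign 4 (nvar 1) (nvar 3))
               (RAssign 6 (nvar 3) (RMinus (Oracle (rvar 4)) (rvar 5))))))))
    (\<lambda>t s'. t \<le> n * 100 + 150 \<and> nats s' 1 0 = i \<and> nats (nats_put 1 0 (Suc i) s') 1 0 = Suc i \<and>
      unchanged {1, 2, 3, 4} {4, 5, 6} s (nats_put 1 0 (Suc i) s') \<and>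
      (\<forall>j\<in>{1..<Suc i}. nats (nats_put 1 0 (Suc i) s') 4 j = Suc (position (reals s 0) n j) \<and>
        reals (nats_put 1 0 (Suc i) s') 6 (Suc (position (reals s 0) n j)) =
          F (Suc (position (reals s 0) n j)))) s1"
    using I by (simp add: s2_def[symmetric])
      (rule wp_mono[OF scan], auto simp: unchanged_def s2_def less_Suc_eq)
next
  fix t s1
  assume t: "t \<le> n * (n * 100 + 150 + 14) + ncost (NConst 1) + 10"
  assume I: "nats s1 1 0 = Suc n \<and> unchanged {1, 2, 3, 4} {4, 5, 6} s s1 \<and>
    (\<forall>j\<in>{1..<Suc n}. nats s1 4 j = Suc (position (reals s 0) n j) \<and>
      reals s1 6 (Suc (position (reals s 0) n j)) = F (Suc (position (reals s 0) n j)))"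
  \<comment> \<open>Positions fill \<open>{..<n}\<close>, so after all rounds every cell from 1 to
    \<open>n\<close> has been written.\<close>
  have "reals s1 6 k = F k" if "k \<in> {1..n}" for k
  proof -
    have "k - 1 \<in> position (reals s 0) n ` {1..n}"
      using bij_betw_position[of "reals s 0" n] that by (auto simp: bij_betw_def)
    then obtain j where j: "j \<in> {1..n}" "k - 1 = position (reals s 0) n j" by blast
    then have "k = Suc (position (reals s 0) n j)" using that by auto
    then show ?thesis using I j by simp
  qed
  then show "t \<le> n * (n * 100 + 200) + 100 \<and>
    unchanged {1, 2, 3, 4} {4, 5, 6} s s1 \<and>
    (\<forall>i\<in>{1..n}. nats s1 4 i = Suc (position (reals s 0) n i)) \<and>
    (\<forall>k\<in>{1..n}. reals s1 6 k = F k)"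
    using t I by (auto simp: algebra_simps)
qed (use assms in \<open>auto simp: unchanged_def\<close>)

text \<open>While the slope at \<open>i\<close> is computed, the outer counter is
  \<open>i + 1\<close>. The candidate \<open>k = i + 1\<close>, with denominator 1, is put into
  array 8 beforehand, so the loop starts at \<open>k = i + 2\<close> with denominator 2.
  Denominators are counted in reals because no expression converts naturals to reals.\<close>

definition slope_prog :: com where
  "slope_prog = for_loop 2 (NPlus (nvar 1) (NConst 1))
     (Seq (Cond (RLess (RDivide (RMinus (RGet 6 (nvar 2)) (rvar 7)) (rvar 9)) (rvar 8))
         (RAssign 8 (NConst 0) (RDivide (RMinus (RGet 6 (nvar 2)) (rvar 7)) (rvar 9)))
         Skip)
       (RAssign 9 (NConst 0) (RPlus (rvar 9) (RConst 1))))"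

lemma wp_slope_prog:
  assumes "nats s 0 0 = n" "nats s 1 0 = Suc i" "i < n" "reals s 9 0 = 2"
    "reals s 8 0 = F (Suc i) - reals s 7 0" and F: "\<And>k. k \<in> {1..n} \<Longrightarrow> reals s 6 k = F k"
  shows "wp \<phi> slope_prog (\<lambda>t s'. t \<le> n * 100 + 100 \<and> unchanged {2} {8, 9} s s' \<and>
    reals s' 8 0 = Min ((\<lambda>k. (F k - reals s 7 0) / real (k - i)) ` {Suc i..n})) s"
  unfolding slope_prog_def
\<comment> \<open>The conjunct \<open>Suc i < j\<close> keeps the range of the minimum
  nonempty.\<close>
proof (rule wp_for_loop[where n = n and B = 60 and I = "\<lambda>j s'. nats s' 2 0 = j \<and> Suc i < j \<and>
    unchanged {2} {8, 9} s s' \<and> reals s' 9 0 = real (j - i) \<and>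
    reals s' 8 0 = Min ((\<lambda>k. (F k - reals s 7 0) / real (k - i)) ` {Suc i..<j})"])
  fix j s1
  assume j: "1 \<le> j" "j \<le> n" and I: "nats s1 2 0 = j \<and> Suc i < j \<and>
    unchanged {2} {8, 9} s s1 \<and> reals s1 9 0 = real (j - i) \<and>
    reals s1 8 0 = Min ((\<lambda>k. (F k - reals s 7 0) / real (k - i)) ` {Suc i..<j})"
  let ?q = "\<lambda>k. (F k - reals s 7 0) / real (k - i)"
  define m where "m = Min (?q ` {Suc i..<j})"
  have "{Suc i..<Suc j} = insert j {Suc i..<j}" using I by auto
  then have Min: "Min (?q ` {Suc i..<Suc j}) = min (?q j) m"
    using I by (simp add: m_def del: of_nat_diff)
  show "wp \<phi> (Seq (Cond (RLess (RDivide (RMinus (RGet 6 (nvar 2)) (rvar 7)) (rvar 9)) (rvar 8))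
         (RAssign 8 (NConst 0) (RDivide (RMinus (RGet 6 (nvar 2)) (rvar 7)) (rvar 9)))
         Skip)
       (RAssign 9 (NConst 0) (RPlus (rvar 9) (RConst 1))))
    (\<lambda>t s'. t \<le> 60 \<and> nats s' 2 0 = j \<and> nats (nats_put 2 0 (Suc j) s') 2 0 = Suc j \<and>
      Suc i < Suc j \<and> unchanged {2} {8, 9} s (nats_put 2 0 (Suc j) s') \<and>
      reals (nats_put 2 0 (Suc j) s') 9 0 = real (Suc j - i) \<and>
      reals (nats_put 2 0 (Suc j) s') 8 0 = Min (?q ` {Suc i..<Suc j})) s1"
    unfolding Min using I[folded m_def] F[of j] j
    by (auto simp: unchanged_def min_def Suc_diff_le not_less simp del: of_nat_diff)
qed (use assms in \<open>auto simp: unchanged_def atLeastLessThanSuc_atLeastAtMost\<close>)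

text \<open>Slopes are stored one cell above their index, matching the positions counted from 1 in
  array 4.\<close>

definition hull_prog :: com where
  "hull_prog = for_loop 1 (NConst 1)
     (Seq (RAssign 9 (NConst 0) (RConst 2))
       (Seq (RAssign 8 (NConst 0) (RMinus (RGet 6 (nvar 1)) (rvar 7)))
         (Seq slope_prog
           (Seq (RAssign 10 (nvar 1) (rvar 8))
             (RAssign 7 (NConst 0) (RPlus (rvar 7) (rvar 8)))))))"

lemma wp_hull_prog:
  assumes "nats s 0 0 = n" "reals s 7 0 = 0" and F: "\<And>k. k \<in> {1..n} \<Longrightarrow> reals s 6 k = F k"
  shows "wp \<phi> hull_prog (\<lambda>t s'. t \<le> n * (n * 100 + 200) + 100 \<and>
    unchanged {1, 2} {7, 8, 9, 10} s s' \<and> (\<forall>k<n. reals s' 10 (Suc k) = hull_slope F n k)) s"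
  unfolding hull_prog_def
proof (rule wp_for_loop[where n = n and B = "n * 100 + 150" and I = "\<lambda>i s'. nats s' 1 0 = i \<and>
    unchanged {1, 2} {7, 8, 9, 10} s s' \<and> reals s' 7 0 = lower_hull F n (i - 1) \<and>
    (\<forall>k<i-1. reals s' 10 (Suc k) = hull_slope F n k)"])
  fix j s1
  assume j: "1 \<le> j" "j \<le> n" and I: "nats s1 1 0 = j \<and>
    unchanged {1, 2} {7, 8, 9, 10} s s1 \<and> reals s1 7 0 = lower_hull F n (j - 1) \<and>
    (\<forall>k<j-1. reals s1 10 (Suc k) = hull_slope F n k)"
  obtain i where i: "j = Suc i" using j by (cases j) auto
  define s2 where "s2 = reals_put 8 0 (reals s1 6 (Suc i) - lower_hull F n i) (reals_put 9 0 2 s1)"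
  have s2: "nats s2 0 0 = n" "nats s2 1 0 = Suc i" "i < n" "reals s2 9 0 = 2"
    "reals s2 8 0 = F (Suc i) - reals s2 7 0" "reals s2 7 0 = lower_hull F n i"
    using I assms(1) j i F[of "Suc i"] by (simp_all add: s2_def unchanged_def)
  have F2: "reals s2 6 k = F k" if "k \<in> {1..n}" for k
    using I F[OF that] by (simp add: s2_def unchanged_def)
  have slope: "wp \<phi> slope_prog (\<lambda>t s'. t \<le> n * 100 + 100 \<and> unchanged {2} {8, 9} s2 s' \<and>
    reals s' 8 0 = hull_slope F n i) s2"
    unfolding hull_slope_def s2(6)[symmetric] by (rule wp_slope_prog[OF s2(1-5) F2])
  show "wp \<phi> (Seq (RAssign 9 (NConst 0) (RConst 2))
       (Seq (RAssign 8 (NConst 0) (RMinus (RGet 6 (nvar 1)) (rvar 7)))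
         (Seq slope_prog
           (Seq (RAssign 10 (nvar 1) (rvar 8))
             (RAssign 7 (NConst 0) (RPlus (rvar 7) (rvar 8)))))))
    (\<lambda>t s'. t \<le> n * 100 + 150 \<and> nats s' 1 0 = j \<and> nats (nats_put 1 0 (Suc j) s') 1 0 = Suc j \<and>
      unchanged {1, 2} {7, 8, 9, 10} s (nats_put 1 0 (Suc j) s') \<and>
      reals (nats_put 1 0 (Suc j) s') 7 0 = lower_hull F n (Suc j - 1) \<and>
      (\<forall>k<Suc j - 1. reals (nats_put 1 0 (Suc j) s') 10 (Suc k) = hull_slope F n k)) s1"
    using I by (simp add: i s2_def[symmetric])
      (rule wp_mono[OF slope], auto simp: unchanged_def s2_def less_Suc_eq hull_Suc)
qed (use assms in \<open>auto simp: unchanged_def algebra_simps\<close>)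

definition output_prog :: com where
  "output_prog = for_loop 1 (NConst 1)
     (RAssign 1 (nvar 1) (RPlus (RGet 3 (nvar 1)) (RGet 10 (NGet 4 (nvar 1)))))"

lemma wp_output_prog:
  assumes "nats s 0 0 = n"
  shows "wp \<phi> output_prog (\<lambda>t s'. t \<le> n * 100 + 100 \<and>
    (\<forall>i\<in>{1..n}. reals s' 1 i = reals s 3 i + reals s 10 (nats s 4 i))) s"
  unfolding output_prog_def
proof (rule wp_for_loop[where n = n and B = 20 and I = "\<lambda>i s'. nats s' 1 0 = i \<and>
      unchanged {1} {1} s s' \<and>
      (\<forall>j\<in>{1..<i}. reals s' 1 j = reals s 3 j + reals s 10 (nats s 4 j))"])
qed (use assms in \<open>auto simp: unchanged_def less_Suc_eq\<close>)

section \<open>Correctness and quadratic time of the whole program\<close>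

definition nash_prog :: com where
  "nash_prog = Seq sum_prog (Seq disagreement_prog (Seq order_prog (Seq hull_prog output_prog)))"

lemma wp_nash_prog:
  fixes P :: "nat \<Rightarrow> real" and \<phi> :: "real \<Rightarrow> real" and n :: nat
  defines "d \<equiv> \<lambda>i. \<phi> (sum P {1..n}) - \<phi> (sum P {1..n} - P i)"
  assumes s: "nats s 0 0 = n" "reals s 0 = P" "reals s 2 0 = 0" "reals s 7 0 = 0"
    and F: "\<And>i. i \<in> {1..n} \<Longrightarrow> F (Suc (position P n i)) =
      \<phi> (sum P (predecessors P (Suc n) i)) - sum d (predecessors P (Suc n) i)"
    and n: "n \<ge> 1"
  shows "wp \<phi> nash_prog (\<lambda>t s'. t \<le> 1500 * n ^ 2 \<and>
    (\<forall>i\<in>{1..n}. reals s' 1 i = d i + hull_slope F n (position P n i))) s"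
proof -
  have "1 \<le> n * n" "n \<le> n * n" using n by simp_all
  \<comment> \<open>The five phases and four sequences cost at most
    \<open>200 * (n * n) + 700 * n + 504\<close>; for \<open>n \<ge> 1\<close> the lower terms are
    absorbed, and 200 + 700 + 600 = 1500.\<close>
  then have time: "t \<le> 1500 * n\<^sup>2" if "t \<le> 200 * (n * n) + 700 * n + 600" for t
    unfolding power2_eq_square using that \<open>1 \<le> n * n\<close> \<open>n \<le> n * n\<close> by linarith
  show ?thesis
    unfolding nash_prog_def wp_Seq
  proof (rule wp_mono[OF wp_sum_prog[OF s(1,3)]], rule wp_mono[OF wp_disagreement_prog[where n = n]],
      goal_cases)
    case (1 t1 s1)
    then show ?case using s by (simp add: unchanged_def)
  next
    case (2 t1 s1 t2 s2)
    have s2: "nats s2 0 0 = n" "reals s2 0 = P" "reals s2 7 0 = 0"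
      "\<And>i. i \<in> {1..n} \<Longrightarrow> reals s2 3 i = d i"
      using 2 s by (auto simp: unchanged_def d_def)
    have "sum (reals s2 3) (predecessors P (Suc n) i) = sum d (predecessors P (Suc n) i)" for i
      using s2(4) by (intro sum.cong) (auto simp: predecessors_def)
    with F have F2: "F (Suc (position (reals s2 0) n i)) =
        \<phi> (sum (reals s2 0) (predecessors (reals s2 0) (Suc n) i))
          - sum (reals s2 3) (predecessors (reals s2 0) (Suc n) i)" if "i \<in> {1..n}" for i
      using that by (simp add: s2(2))
    show ?case
    proof (rule wp_mono[OF wp_order_prog[OF s2(1) F2]], assumption,
        rule wp_mono[OF wp_hull_prog[where n = n and F = F]], goal_cases)
      case (4 t3 s3 t4 s4)
      then have s4: "nats s4 0 0 = n" "\<And>i. i \<in> {1..n} \<Longrightarrow> reals s4 3 i = d i"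
        "\<And>i. i \<in> {1..n} \<Longrightarrow> nats s4 4 i = Suc (position P n i)"
        using s2 by (auto simp: unchanged_def)
      have "reals s4 10 (nats s4 4 i) = hull_slope F n (position P n i)" if "i \<in> {1..n}" for i
        using 4 bij_betwE[OF bij_betw_position] that s4(3)[OF that] by auto
      with s4 show ?case
        using 2 4 by (intro wp_mono[OF wp_output_prog[OF s4(1)]] conjI time) (auto simp: algebra_simps)
    qed (use s2 in \<open>auto simp: unchanged_def\<close>)
  qed
qed

theorem proposition23:
  shows "\<exists>(prog :: com) (T :: nat \<Rightarrow> nat).
    (\<lambda>K. real (T K)) \<in> O(\<lambda>K. real K ^ 2) \<and>
    (\<forall>(K :: nat) (g :: nat set \<Rightarrow> real) (P :: nat \<Rightarrow> real) (\<phi> :: real \<Rightarrow> real).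
       K \<ge> 1 \<and> rank_function {1..K} g \<and> generalized_symmetric {1..K} P \<phi> g \<longrightarrow>
       (\<exists>t s. exec \<phi> prog (input_store K P) t s \<and> t \<le> T K \<and>
          nash_bargaining_solution {1..K} (polymatroid {1..K} g)
            (canonical_disagreement {1..K} g) (output_vector K s)))"
proof (intro exI[of _ nash_prog] exI[of _ "\<lambda>n. 1500 * n ^ 2"] conjI allI impI)
  show "(\<lambda>K. real (1500 * K ^ 2)) \<in> O(\<lambda>K. real K ^ 2)" by simp
next
  fix K :: nat and g P \<phi>
  assume A: "1 \<le> K \<and> rank_function {1..K} g \<and> generalized_symmetric {1..K} P \<phi> g"
  let ?\<Omega> = "{1..K}"
  \<comment> \<open>The input store holds 0 outside \<open>{1..K}\<close>; \<open>P'\<close> equals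
    its array 0 everywhere and has the same sums as \<open>P\<close> over subsets of
    \<open>{1..K}\<close>.\<close>
  define P' where "P' i = (if i \<in> ?\<Omega> then P i else 0)" for i
  define \<rho> where "\<rho> = position P' K"
  define F where "F k = bargaining_surplus ?\<Omega> g (initial_set ?\<Omega> \<rho> k)" for k
  define d where "d i = \<phi> (sum P' ?\<Omega>) - \<phi> (sum P' ?\<Omega> - P' i)" for i
  have "sum P' S = sum P S" if "S \<subseteq> ?\<Omega>" for S
    using that by (intro sum.cong) (auto simp: P'_def)
  then have gs: "generalized_symmetric ?\<Omega> P' \<phi> g"
    using A by (auto simp: generalized_symmetric_def P'_def)
  then have g: "g S = \<phi> (sum P' S)" if "S \<subseteq> ?\<Omega>" for S
    using that by (simp add: generalized_symmetric_def)
  have d: "canonical_disagreement ?\<Omega> g i = d i" if "i \<in> ?\<Omega>" for i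
    using that by (simp add: canonical_disagreement_def g d_def sum_diff1)
  \<comment> \<open>This meets the assumption of \<open>wp_nash_prog\<close> on \<open>F\<close>:
    the predecessors of \<open>i\<close> form the initial set of size
    \<open>Suc (\<rho> i)\<close>.\<close>
  have F_pred: "F (Suc (\<rho> i)) =
      \<phi> (sum P' (predecessors P' (Suc K) i)) - sum d (predecessors P' (Suc K) i)"
    if "i \<in> ?\<Omega>" for i
  proof -
    have I: "initial_set ?\<Omega> \<rho> (Suc (\<rho> i)) \<subseteq> ?\<Omega>" by (auto simp: initial_set_def)
    then have "sum (canonical_disagreement ?\<Omega> g) (initial_set ?\<Omega> \<rho> (Suc (\<rho> i))) =
        sum d (initial_set ?\<Omega> \<rho> (Suc (\<rho> i)))"
      by (intro sum.cong d) auto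
    then show ?thesis
      using g[OF I] predecessors_eq_initial_set[OF that]
      by (simp add: F_def bargaining_surplus_def \<rho>_def)
  qed
  have "wp \<phi> nash_prog (\<lambda>t s. t \<le> 1500 * K ^ 2 \<and>
      (\<forall>i\<in>?\<Omega>. reals s 1 i = d i + hull_slope F K (\<rho> i))) (input_store K P)"
    unfolding d_def \<rho>_def
    using A F_pred by (intro wp_nash_prog) (auto simp: input_store_def P'_def d_def \<rho>_def fun_eq_iff)
  then obtain t s where ts: "exec \<phi> nash_prog (input_store K P) t s" "t \<le> 1500 * K ^ 2"
    "\<And>i. i \<in> ?\<Omega> \<Longrightarrow> reals s 1 i = d i + hull_slope F K (\<rho> i)"
    unfolding wp_def by blast
  have "output_vector K s =
      (\<lambda>i\<in>?\<Omega>. canonical_disagreement ?\<Omega> g i + hull_slope F K (\<rho> i))"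
    unfolding output_vector_def using ts(3) d by (intro restrict_ext) simp
  moreover have "nash_bargaining_solution ?\<Omega> (polymatroid ?\<Omega> g) (canonical_disagreement ?\<Omega> g)
      (\<lambda>i\<in>?\<Omega>. canonical_disagreement ?\<Omega> g i + hull_slope F K (\<rho> i))"
  proof (rule nash_bargaining_solution_hull[OF _ gs])
    show "bij_betw \<rho> ?\<Omega> {..<K}" unfolding \<rho>_def by (rule bij_betw_position)
    show "P' j \<le> P' i" if "i \<in> ?\<Omega>" "j \<in> ?\<Omega>" "\<rho> j \<le> \<rho> i" for i j
      using that position_le_iff[of i K j P'] by (auto simp: \<rho>_def predecessors_def)
  qed (use A F_def in auto)
  ultimately have "nash_bargaining_solution ?\<Omega> (polymatroid ?\<Omega> g) (canonical_disagreement ?\<Omega> g)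
      (output_vector K s)" by simp
  with ts(1,2) show "\<exists>t s. exec \<phi> nash_prog (input_store K P) t s \<and> t \<le> 1500 * K ^ 2 \<and>
      nash_bargaining_solution ?\<Omega> (polymatroid ?\<Omega> g) (canonical_disagreement ?\<Omega> g)
        (output_vector K s)"
    by blast
qed

end
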